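(* Assume that the noise terms $\xi_i$, $i=1,\dots,n$, are centered Gaussian random variables with a given variance $\sigma^2>0$. For every $r\ge d+1$, we have the following lower bound: $$\inf_{\hat P}\sup_{P\in\mathcal P_r}\mathbb E_P\big[|\hat P\triangle P|\big] \geq \frac{\alpha^2\sigma^2\ln n}{n},$$ where $\alpha=\frac12-\frac{\ln 2}{2\ln 3}$ and the infimum is over all set estimators $\hat P$ based on $n$ observations.
   Context: Let $d\ge 2$ be an integer. One observes $n$ i.i.d. pairs $(X_i,Y_i)$, $i=1,\dots,n$, with $X_i$ uniformly distributed on $[0,1]^d$ and $Y_i=I(X_i\in G)+\xi_i$, where $G\subseteq[0,1]^d$ is unknown, $I(\cdot\in G)$ is the indicator function of $G$, and the errors $\xi_1,\dots,\xi_n$ are i.i.d. real random variables independent of $(X_1,\dots,X_n)$. $\mathbb E_G$ denotes expectation with respect to the distribution of the $n$ pairs when the unknown set is $G$. $|\cdot|$ is Lebesgue measure on $\mathbb R^d$ and $\triangle$ is symmetric difference. A set estimator based on $n$ observations is a Borel subset $\hat G_n$ of $[0,1]^d$ for which there is a real measurable function $f$ with $I(\cdot\in\hat G_n)=f(\cdot,X_1,Y_1,\dots,X_n,Y_n)$. All convex sets (in particular polytopes) considered are compact with nonempty interior. For an integer $r\ge d+1$, $\mathcal P_r$ is the class of all convex polytopes contained in $[0,1]^d$ with at most $r$ vertices.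
   Formalization: The bound is stated for all n ≥ N, with N depending on d and σ but not on r; for every n it is false, since the empty-set estimator has risk at most 1 while α²σ² ln n / n exceeds 1 for n = 2 and σ large. *)

theory Defs
  imports "HOL-Probability.Probability"
begin

text \<open>Law of a single pair \<open>(X, Y)\<close> with \<open>Y = I(X \<in> G) + \<xi>\<close>, where \<open>X\<close> is uniform on the unit cube and
  \<open>\<xi>\<close> is independent of \<open>X\<close> with law \<open>\<nu>\<close>. In \<open>real ^ 'd\<close> the constant \<open>1\<close> is the all-ones vector,
  so \<open>cbox 0 1\<close> is the unit cube.\<close>

definition observation_law ::
    "real measure \<Rightarrow> (real ^ 'd::finite) set \<Rightarrow> ((real ^ 'd) \<times> real) measure" where
  "observation_law \<nu> G =
     distr (uniform_measure lborel (cbox 0 1) \<Otimes>\<^sub>M \<nu>) (borel \<Otimes>\<^sub>M borel)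
       (\<lambda>(x, \<xi>). (x, indicator G x + \<xi>))"

definition sample_law ::
    "real measure \<Rightarrow> nat \<Rightarrow> (real ^ 'd::finite) set \<Rightarrow> (nat \<Rightarrow> (real ^ 'd) \<times> real) measure" where
  "sample_law \<nu> n G = (\<Pi>\<^sub>M i\<in>{..<n}. observation_law \<nu> G)"

definition gaussian_noise :: "real \<Rightarrow> real measure" where
  "gaussian_noise \<sigma> = density lborel (\<lambda>x. ennreal (normal_density 0 \<sigma> x))"

text \<open>The measurable space of samples does not depend on the unknown set.\<close>

definition sample_space ::
    "nat \<Rightarrow> (nat \<Rightarrow> (real ^ 'd::finite) \<times> real) measure" where
  "sample_space n = (\<Pi>\<^sub>M i\<in>{..<n}. borel \<Otimes>\<^sub>M borel)"

definition set_estimators ::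
    "nat \<Rightarrow> ((nat \<Rightarrow> (real ^ 'd::finite) \<times> real) \<Rightarrow> (real ^ 'd) set) set" where
  "set_estimators n =
     {Ghat. (\<forall>D \<in> space (sample_space n). Ghat D \<in> sets borel \<and> Ghat D \<subseteq> cbox 0 1) \<and>
            (\<exists>f :: (real ^ 'd) \<times> (nat \<Rightarrow> (real ^ 'd) \<times> real) \<Rightarrow> real.
               f \<in> borel_measurable (borel \<Otimes>\<^sub>M sample_space n) \<and>
               (\<forall>x. \<forall>D \<in> space (sample_space n). indicator (Ghat D) x = f (x, D)))}"

text \<open>The vertices of a polytope are its extreme points. There are finitely many of them, so the
  cardinality below is never that of an infinite set. Compactness and convexity are part of
  \<^const>\<open>polytope\<close>.\<close>

definition polytope_class :: "nat \<Rightarrow> (real ^ 'd::finite) set set" where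
  "polytope_class r =
     {P. polytope P \<and> interior P \<noteq> {} \<and> P \<subseteq> cbox 0 1 \<and> card {v. v extreme_point_of P} \<le> r}"

text \<open>Expected Lebesgue measure of the symmetric difference. Taken in \<^typ>\<open>ennreal\<close>, where the infimum
  and supremum over arbitrary families need no boundedness side conditions.\<close>

definition risk ::
    "real measure \<Rightarrow> nat \<Rightarrow> ((nat \<Rightarrow> (real ^ 'd::finite) \<times> real) \<Rightarrow> (real ^ 'd) set) \<Rightarrow>
     (real ^ 'd) set \<Rightarrow> ennreal" where
  "risk \<nu> n Ghat G = (\<integral>\<^sup>+ D. emeasure lborel (sym_diff (Ghat D) G) \<partial>sample_law \<nu> n G)"

definition minimax_risk ::
    "real measure \<Rightarrow> nat \<Rightarrow> (real ^ 'd::finite) set set \<Rightarrow> ennreal" where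
  "minimax_risk \<nu> n \<C> = (INF Ghat \<in> set_estimators n. SUP G \<in> \<C>. risk \<nu> n Ghat G)"

end

theory Submission
  imports Defs "HOL-Real_Asymp.Real_Asymp"
begin

text \<open>
  Bayesian lower bound with a uniform prior on \<open>M\<close> simplices \<open>P\<^sub>k\<close> with disjoint interiors, all of the
  same volume \<open>h = 1 / (d! M)\<close>: each is the standard simplex squeezed by \<open>1 / M\<close> in one coordinate
  direction and placed in the \<open>k\<close>-th slab of the cube. Comparing the overlaps of an estimator with
  the \<open>P\<^sub>k\<close>, its loss at \<open>P\<^sub>k\<close> is at least \<open>h - a\<^sub>k\<close>, where \<open>a\<^sub>k \<ge> 0\<close> depends on the sample and
  \<open>\<Sum>\<^sub>k a\<^sub>k \<le> h\<close>. The law of the sample under \<open>P\<^sub>k\<close> has a density \<open>L\<^sub>k\<close> with respect to the law for the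
  empty set, and \<open>L\<^sub>k a\<^sub>k \<le> \<tau> a\<^sub>k + h \<tau>\<^sup>-\<^sup>s L\<^sub>k\<^sup>1\<^sup>+\<^sup>s\<close>. Averaging over \<open>k\<close>, the maximal risk is at least
  \<open>h (1 - \<tau> / M - \<tau>\<^sup>-\<^sup>s E[L\<^sub>k\<^sup>1\<^sup>+\<^sup>s])\<close>. With \<open>\<tau> = M / 4\<close> and \<open>h\<close> between \<open>1/8\<close> and \<open>1/4\<close> of
  \<open>\<sigma>\<^sup>2 ln n / n\<close>, the last term tends to \<open>0\<close> for a small fixed \<open>s\<close>, which leaves at least \<open>h / 2\<close>.
  This is enough because \<open>\<alpha>\<^sup>2 \<le> 1/16\<close>.
\<close>

subsection \<open>Likelihood ratios with respect to the empty set\<close>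

text \<open>For \<open>0 < \<sigma>\<close>, the density of one pair under \<open>G\<close> relative
  to the empty set: the quotient of the Gaussian densities with means 1 and 0 on \<open>G\<close>,
  and 1 off \<open>G\<close>. With the indicator in the exponent, both cases form one positive
  expression whose powers are again exponentials.\<close>

definition likelihood_ratio :: "real \<Rightarrow> (real ^ 'd::finite) set \<Rightarrow> (real ^ 'd) \<times> real \<Rightarrow> real" where
  "likelihood_ratio \<sigma> G z = exp (indicator G (fst z) * (2 * snd z - 1) / (2 * \<sigma>\<^sup>2))"

lemma likelihood_ratio_pos: "0 < likelihood_ratio \<sigma> G z"
  by (simp add: likelihood_ratio_def)

lemma measurable_likelihood_ratio [measurable]:
  assumes [measurable]: "G \<in> sets borel"
  shows "likelihood_ratio \<sigma> G \<in> borel_measurable (borel \<Otimes>\<^sub>M borel)"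
  unfolding likelihood_ratio_def by measurable

lemma sets_observation_law [simp, measurable_cong]:
  "sets (observation_law \<nu> G) = sets (borel \<Otimes>\<^sub>M borel)"
  by (simp add: observation_law_def)

lemma sets_sample_law [simp, measurable_cong]:
  "sets (sample_law \<nu> n G) = sets (sample_space n)"
  unfolding sample_law_def sample_space_def by (intro sets_PiM_cong) auto

section \<open>Uniform design and Gaussian integrals for a single observation\<close>

lemma inner_one_Basis: "b \<in> Basis \<Longrightarrow> (1 :: real ^ 'd::finite) \<bullet> b = 1"
  by (auto simp: Basis_vec_def inner_axis)

lemma emeasure_unit_cube: "emeasure lborel (cbox 0 1 :: (real ^ 'd::finite) set) = 1"
  by (simp add: emeasure_lborel_cbox_eq inner_one_Basis)

lemma prob_space_unit_cube: "prob_space (uniform_measure lborel (cbox 0 1 :: (real ^ 'd::finite) set))"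
  by (intro prob_space_uniform_measure) (simp_all add: emeasure_unit_cube)

lemma nn_integral_normal_density:
  assumes "0 < \<sigma>"
  shows "(\<integral>\<^sup>+y. ennreal (normal_density \<mu> \<sigma> y) \<partial>lborel) = 1"
  using prob_space.emeasure_space_1[OF prob_space_normal_density[OF assms, of \<mu>]]
  by (simp add: emeasure_density)

text \<open>Completing the square, with \<open>g\<^sup>2 = g\<close>. The left factor is the
  \<open>t\<close>-th power of the likelihood ratio: \<open>t = 1\<close> identifies the ratio as a
  density, and general \<open>t\<close> yields its moments.\<close>

lemma normal_density_tilt:
  assumes "0 < \<sigma>" "g = 0 \<or> g = 1"
  shows "exp (t * (g * (2 * y - 1) / (2 * \<sigma>\<^sup>2))) * normal_density 0 \<sigma> y =
    exp (g * (t * (t - 1)) / (2 * \<sigma>\<^sup>2)) * normal_density (t * g) \<sigma> y"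
proof -
  have "t * (g * (2 * y - 1) / (2 * \<sigma>\<^sup>2)) + - (y - 0)\<^sup>2 / (2 * \<sigma>\<^sup>2) =
    g * (t * (t - 1)) / (2 * \<sigma>\<^sup>2) + - (y - t * g)\<^sup>2 / (2 * \<sigma>\<^sup>2)"
    using assms by (auto simp: field_simps power2_eq_square)
  then have "exp (t * (g * (2 * y - 1) / (2 * \<sigma>\<^sup>2))) * exp (- (y - 0)\<^sup>2 / (2 * \<sigma>\<^sup>2)) =
    exp (g * (t * (t - 1)) / (2 * \<sigma>\<^sup>2)) * exp (- (y - t * g)\<^sup>2 / (2 * \<sigma>\<^sup>2))"
    by (simp only: exp_add[symmetric])
  then show ?thesis
    by (simp add: normal_density_def)
qed

text \<open>Tonelli in design and noise, then a translation of the noise. The set enters only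
  through the mean of the Gaussian density and \<open>f\<close> stays unshifted, so laws for
  different sets can be compared pointwise.\<close>

lemma nn_integral_observation_law:
  fixes f :: "(real ^ 'd::finite) \<times> real \<Rightarrow> ennreal"
  assumes \<sigma>: "0 < \<sigma>" and G [measurable]: "G \<in> sets borel"
    and f [measurable]: "f \<in> borel_measurable (borel \<Otimes>\<^sub>M borel)"
  shows "(\<integral>\<^sup>+z. f z \<partial>observation_law (gaussian_noise \<sigma>) G) =
    (\<integral>\<^sup>+x. (\<integral>\<^sup>+y. f (x, y) * normal_density (indicator G x) \<sigma> y \<partial>lborel)
      \<partial>uniform_measure lborel (cbox 0 1))"
proof -
  interpret N: prob_space "gaussian_noise \<sigma>"
    unfolding gaussian_noise_def by (rule prob_space_normal_density[OF \<sigma>])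
  have [measurable_cong]: "sets (gaussian_noise \<sigma>) = sets borel"
    by (simp add: gaussian_noise_def)
  have "(\<integral>\<^sup>+z. f z \<partial>observation_law (gaussian_noise \<sigma>) G) =
    (\<integral>\<^sup>+z. f (case z of (x, \<xi>) \<Rightarrow> (x, indicator G x + \<xi>))
      \<partial>(uniform_measure lborel (cbox 0 1) \<Otimes>\<^sub>M gaussian_noise \<sigma>))"
    unfolding observation_law_def by (subst nn_integral_distr) auto
  also have "\<dots> = (\<integral>\<^sup>+x. (\<integral>\<^sup>+\<xi>. f (x, indicator G x + \<xi>) \<partial>gaussian_noise \<sigma>)
      \<partial>uniform_measure lborel (cbox 0 1))"
    by (subst N.nn_integral_fst[symmetric]) auto
  also have "\<dots> = (\<integral>\<^sup>+x. (\<integral>\<^sup>+y. f (x, y) * normal_density (indicator G x) \<sigma> y \<partial>lborel)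
      \<partial>uniform_measure lborel (cbox 0 1))"
  proof (intro nn_integral_cong)
    fix x :: "real ^ 'd"
    have "(\<integral>\<^sup>+\<xi>. f (x, indicator G x + \<xi>) \<partial>gaussian_noise \<sigma>) =
      (\<integral>\<^sup>+\<xi>. f (x, indicator G x + \<xi>) * normal_density 0 \<sigma> \<xi> \<partial>lborel)"
      unfolding gaussian_noise_def by (subst nn_integral_density) (auto simp: mult.commute)
    also have "\<dots> = (\<integral>\<^sup>+y. f (x, y) * normal_density (indicator G x) \<sigma> y \<partial>lborel)"
      by (subst (2) nn_integral_real_affine[where c=1 and t="indicator G x"])
        (auto simp: normal_density_def)
    finally show "(\<integral>\<^sup>+\<xi>. f (x, indicator G x + \<xi>) \<partial>gaussian_noise \<sigma>) =
      (\<integral>\<^sup>+y. f (x, y) * normal_density (indicator G x) \<sigma> y \<partial>lborel)" .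
  qed
  finally show ?thesis .
qed

lemma prob_space_observation_law:
  assumes \<sigma>: "0 < \<sigma>" and G [measurable]: "G \<in> sets borel"
  shows "prob_space (observation_law (gaussian_noise \<sigma>) (G :: (real ^ 'd::finite) set))"
proof
  interpret U: prob_space "uniform_measure lborel (cbox 0 1 :: (real ^ 'd) set)"
    by (rule prob_space_unit_cube)
  have "emeasure (observation_law (gaussian_noise \<sigma>) G) (space (observation_law (gaussian_noise \<sigma>) G)) =
    (\<integral>\<^sup>+z. 1 \<partial>observation_law (gaussian_noise \<sigma>) G)"
    by simp
  also have "\<dots> = 1"
    by (subst nn_integral_observation_law[OF \<sigma> G])
      (use U.emeasure_space_1 in \<open>auto simp: nn_integral_normal_density[OF \<sigma>]\<close>)
  finally show "emeasure (observation_law (gaussian_noise \<sigma>) G)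
    (space (observation_law (gaussian_noise \<sigma>) G)) = 1" .
qed

text \<open>In the tilt identity the constant factor is 1 at \<open>t = 1\<close>, so the ratio
  turns the noise density centred at 0 into the one centred at \<open>indicator G x\<close>.\<close>

lemma observation_law_eq_density:
  assumes \<sigma>: "0 < \<sigma>" and G [measurable]: "G \<in> sets borel"
  shows "observation_law (gaussian_noise \<sigma>) G =
    density (observation_law (gaussian_noise \<sigma>) {}) (likelihood_ratio \<sigma> G)"
proof (rule measure_eqI)
  fix A assume "A \<in> sets (observation_law (gaussian_noise \<sigma>) G)"
  then have A [measurable]: "A \<in> sets (borel \<Otimes>\<^sub>M borel)" by simp
  have "emeasure (density (observation_law (gaussian_noise \<sigma>) {}) (likelihood_ratio \<sigma> G)) A =
    (\<integral>\<^sup>+z. ennreal (likelihood_ratio \<sigma> G z) * indicator A z \<partial>observation_law (gaussian_noise \<sigma>) {})"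
    by (simp add: emeasure_density)
  also have "\<dots> = (\<integral>\<^sup>+z. indicator A z \<partial>observation_law (gaussian_noise \<sigma>) G)"
     proof -
    have *: "ennreal (likelihood_ratio \<sigma> G (x, y)) * indicator A (x, y) * ennreal (normal_density 0 \<sigma> y) =
      indicator A (x, y) * ennreal (normal_density (indicator G x) \<sigma> y)" for x y
      using normal_density_tilt[OF \<sigma>, of "indicator G x" 1 y]
      by (auto simp: likelihood_ratio_def indicator_def ennreal_mult[symmetric])
    show ?thesis
      by (subst (1 2) nn_integral_observation_law[OF \<sigma>]) (auto simp: *)
  qed
  also have "\<dots> = emeasure (observation_law (gaussian_noise \<sigma>) G) A" by simp
  finally show "emeasure (observation_law (gaussian_noise \<sigma>) G) A =
    emeasure (density (observation_law (gaussian_noise \<sigma>) {}) (likelihood_ratio \<sigma> G)) A" ..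
qed simp

text \<open>The inner Gaussian integral is \<open>exp \<kappa>\<close> on \<open>G\<close> and 1
  elsewhere, so the moment equals \<open>1 + h * (exp \<kappa> - 1)\<close>. Passing to an
  exponential makes the bounds for independent observations easy to multiply.\<close>

lemma nn_integral_likelihood_ratio_powr:
  assumes \<sigma>: "0 < \<sigma>" and G [measurable]: "G \<in> sets borel" and sub: "G \<subseteq> cbox 0 1"
    and h: "0 \<le> h" "emeasure lborel G = ennreal h" and \<kappa>: "t * (t - 1) / (2 * \<sigma>\<^sup>2) = \<kappa>" "0 \<le> \<kappa>"
  shows "(\<integral>\<^sup>+z. likelihood_ratio \<sigma> G z powr t \<partial>observation_law (gaussian_noise \<sigma>) {})
    \<le> exp (h * (exp \<kappa> - 1))"
proof -
  interpret U: prob_space "uniform_measure lborel (cbox 0 1 :: (real ^ 'a) set)"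
    by (rule prob_space_unit_cube)
  have *: "ennreal (likelihood_ratio \<sigma> G (x, y) powr t) * normal_density 0 \<sigma> y =
    ennreal (1 + indicator G x * (exp \<kappa> - 1)) * normal_density (t * indicator G x) \<sigma> y" for x y
  proof -
    have "likelihood_ratio \<sigma> G (x, y) powr t * normal_density 0 \<sigma> y =
      exp (indicator G x * (t * (t - 1)) / (2 * \<sigma>\<^sup>2)) * normal_density (t * indicator G x) \<sigma> y"
      using normal_density_tilt[OF \<sigma>, of "indicator G x" t y]
      by (auto simp: likelihood_ratio_def exp_powr_real indicator_def mult_ac)
    also have "exp (indicator G x * (t * (t - 1)) / (2 * \<sigma>\<^sup>2)) = 1 + indicator G x * (exp \<kappa> - 1)"
      using \<kappa> by (auto simp: indicator_def)
    finally show ?thesis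
      using \<kappa> by (simp add: ennreal_mult[symmetric] indicator_def del: ennreal_plus)
  qed
  have "(\<integral>\<^sup>+z. likelihood_ratio \<sigma> G z powr t \<partial>observation_law (gaussian_noise \<sigma>) {}) =
    (\<integral>\<^sup>+x. ennreal (1 + indicator G x * (exp \<kappa> - 1)) \<partial>uniform_measure lborel (cbox 0 1))"
    by (subst nn_integral_observation_law[OF \<sigma>])
      (auto simp: * nn_integral_cmult nn_integral_normal_density[OF \<sigma>])
  also have "\<dots> = (\<integral>\<^sup>+x. 1 + ennreal (exp \<kappa> - 1) * indicator G x \<partial>uniform_measure lborel (cbox 0 1))"
    using ennreal_plus[of 1 "exp \<kappa> - 1"] \<kappa>(2)
    by (intro nn_integral_cong) (simp add: indicator_def)
  also have "\<dots> = 1 + ennreal (exp \<kappa> - 1) * emeasure (uniform_measure lborel (cbox 0 1)) G"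
    using U.emeasure_space_1 by (subst nn_integral_add) (auto simp: nn_integral_cmult_indicator)
  also have "emeasure (uniform_measure lborel (cbox 0 1)) G = ennreal h"
    using sub h divide_ennreal[of h 1] by (simp add: emeasure_unit_cube Int_absorb1)
  also have "1 + ennreal (exp \<kappa> - 1) * ennreal h = ennreal (1 + h * (exp \<kappa> - 1))"
    using \<kappa> h by (simp add: ennreal_mult[symmetric] mult.commute)
  also have "\<dots> \<le> ennreal (exp (h * (exp \<kappa> - 1)))"
    by (intro ennreal_leI exp_ge_add_one_self)
  finally show ?thesis .
qed

section \<open>From one observation to the whole sample\<close>

lemma PiM_density:
  assumes "finite I" and M: "sigma_finite_measure M" and D: "sigma_finite_measure (density M f)"
    and f [measurable]: "f \<in> borel_measurable M"
  shows "PiM I (\<lambda>_. density M f) = density (PiM I (\<lambda>_. M)) (\<lambda>x. \<Prod>i\<in>I. f (x i))"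
proof -
  interpret M: product_sigma_finite "\<lambda>_. M" using M by (simp add: product_sigma_finite_def)
  interpret D: product_sigma_finite "\<lambda>_. density M f" using D by (simp add: product_sigma_finite_def)
  show ?thesis
  \<comment> \<open>A product measure is determined by its values on boxes, where the integral
    factorizes.\<close>
  proof (rule D.PiM_eqI[symmetric, OF \<open>finite I\<close>])
    show "sets (density (Pi\<^sub>M I (\<lambda>_. M)) (\<lambda>x. \<Prod>i\<in>I. f (x i))) = sets (Pi\<^sub>M I (\<lambda>_. density M f))"
      by (simp cong: sets_PiM_cong)
    fix A assume "\<And>i. i \<in> I \<Longrightarrow> A i \<in> sets (density M f)"
    then have A [measurable]: "\<And>i. i \<in> I \<Longrightarrow> A i \<in> sets M" by simp
    have "emeasure (density (Pi\<^sub>M I (\<lambda>_. M)) (\<lambda>x. \<Prod>i\<in>I. f (x i))) (Pi\<^sub>E I A) =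
      (\<integral>\<^sup>+x. (\<Prod>i\<in>I. f (x i)) * indicator (Pi\<^sub>E I A) x \<partial>Pi\<^sub>M I (\<lambda>_. M))"
      using \<open>finite I\<close> by (intro emeasure_density) (auto intro!: sets_PiM_I_finite)
    also have "\<dots> = (\<integral>\<^sup>+x. (\<Prod>i\<in>I. f (x i) * indicator (A i) (x i)) \<partial>Pi\<^sub>M I (\<lambda>_. M))"
    proof (intro nn_integral_cong)
      fix x assume "x \<in> space (Pi\<^sub>M I (\<lambda>_. M))"
      \<comment> \<open>Membership in \<open>Pi\<^sub>E I A\<close> also prescribes the value
        \<open>undefined\<close> outside \<open>I\<close>. Points of the product space satisfy this,
        so only the coordinates in \<open>I\<close> decide.\<close>
      then have "x \<in> extensional I" by (auto simp: space_PiM PiE_def)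
      then have "indicator (Pi\<^sub>E I A) x = (\<Prod>i\<in>I. indicator (A i) (x i) :: ennreal)"
        using \<open>finite I\<close> by (auto simp: indicator_def PiE_iff prod_zero_iff)
      then show "(\<Prod>i\<in>I. f (x i)) * indicator (Pi\<^sub>E I A) x = (\<Prod>i\<in>I. f (x i) * indicator (A i) (x i))"
        by (simp add: prod.distrib)
    qed
    also have "\<dots> = (\<Prod>i\<in>I. emeasure (density M f) (A i))"
      using \<open>finite I\<close> by (subst M.product_nn_integral_prod) (auto simp: emeasure_density)
    finally show "emeasure (density (Pi\<^sub>M I (\<lambda>_. M)) (\<lambda>x. \<Prod>i\<in>I. f (x i))) (Pi\<^sub>E I A) =
      (\<Prod>i\<in>I. emeasure (density M f) (A i))" .
  qed
qed

definition sample_ratio :: "real \<Rightarrow> nat \<Rightarrow> (real ^ 'd::finite) set \<Rightarrow> (nat \<Rightarrow> (real ^ 'd) \<times> real) \<Rightarrow> real" where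
  "sample_ratio \<sigma> n G D = (\<Prod>i<n. likelihood_ratio \<sigma> G (D i))"

lemma sample_ratio_pos: "0 < sample_ratio \<sigma> n G D"
  by (simp add: sample_ratio_def likelihood_ratio_pos prod_pos)

lemma measurable_sample_ratio [measurable]:
  assumes [measurable]: "G \<in> sets borel"
  shows "sample_ratio \<sigma> n G \<in> borel_measurable (sample_space n)"
  unfolding sample_ratio_def sample_space_def by measurable

lemma prob_space_sample_law:
  assumes "0 < \<sigma>" "G \<in> sets borel"
  shows "prob_space (sample_law (gaussian_noise \<sigma>) n G)"
  unfolding sample_law_def by (intro prob_space_PiM prob_space_observation_law assms)

lemma sample_law_eq_density:
  assumes \<sigma>: "0 < \<sigma>" and G [measurable]: "G \<in> sets borel"
  shows "sample_law (gaussian_noise \<sigma>) n G =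
    density (sample_law (gaussian_noise \<sigma>) n {}) (sample_ratio \<sigma> n G)"
proof -
  have 1: "sigma_finite_measure (observation_law (gaussian_noise \<sigma>) {} :: ((real ^ 'a) \<times> real) measure)"
    by (intro prob_space_imp_sigma_finite prob_space_observation_law \<sigma>) auto
  \<comment> \<open>The density is again an observation law, hence a probability measure.\<close>
  have 2: "sigma_finite_measure (density (observation_law (gaussian_noise \<sigma>) {}) (likelihood_ratio \<sigma> G))"
    unfolding observation_law_eq_density[OF \<sigma> G, symmetric]
    by (intro prob_space_imp_sigma_finite prob_space_observation_law \<sigma> G)
  show ?thesis
    unfolding sample_law_def observation_law_eq_density[OF \<sigma> G]
    by (subst PiM_density[OF _ 1 2])
      (auto simp: sample_ratio_def prod_ennreal likelihood_ratio_pos less_imp_le)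
qed

text \<open>The observations are independent under the empty set, so the moment is a product of
  \<open>n\<close> moments of single ratios.\<close>

lemma nn_integral_sample_ratio_powr:
  assumes \<sigma>: "0 < \<sigma>" and G [measurable]: "G \<in> sets borel" and sub: "G \<subseteq> cbox 0 1"
    and h: "0 \<le> h" "emeasure lborel G = ennreal h" and \<kappa>: "t * (t - 1) / (2 * \<sigma>\<^sup>2) = \<kappa>" "0 \<le> \<kappa>"
  shows "(\<integral>\<^sup>+D. sample_ratio \<sigma> n G D powr t \<partial>sample_law (gaussian_noise \<sigma>) n {})
    \<le> exp (real n * h * (exp \<kappa> - 1))"
proof -
  interpret product_sigma_finite "\<lambda>_::nat. observation_law (gaussian_noise \<sigma>) ({} :: (real ^ 'a) set)"
    unfolding product_sigma_finite_def
    by (intro allI prob_space_imp_sigma_finite prob_space_observation_law \<sigma>) auto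
  have "(\<integral>\<^sup>+D. sample_ratio \<sigma> n G D powr t \<partial>sample_law (gaussian_noise \<sigma>) n {}) =
    (\<integral>\<^sup>+D. (\<Prod>i<n. ennreal (likelihood_ratio \<sigma> G (D i) powr t)) \<partial>sample_law (gaussian_noise \<sigma>) n {})"
    by (auto simp: sample_ratio_def prod_ennreal prod_powr_distrib likelihood_ratio_pos less_imp_le
        intro!: nn_integral_cong)
  also have "\<dots> = (\<Prod>i<n. \<integral>\<^sup>+z. likelihood_ratio \<sigma> G z powr t \<partial>observation_law (gaussian_noise \<sigma>) {})"
    unfolding sample_law_def by (rule product_nn_integral_prod) auto
  also have "\<dots> \<le> (\<Prod>i<n. ennreal (exp (h * (exp \<kappa> - 1))))"
    by (intro prod_mono_ennreal nn_integral_likelihood_ratio_powr assms)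
  also have "\<dots> = ennreal (exp (real n * h * (exp \<kappa> - 1)))"
    by (simp add: ennreal_power exp_of_nat_mult[symmetric] mult.assoc)
  finally show ?thesis .
qed

subsection \<open>Estimators against disjoint hypotheses\<close>

lemma sum_excess_le:
  fixes g :: "'i \<Rightarrow> real"
  assumes "finite I" "0 \<le> h" and g: "\<And>k. k \<in> I \<Longrightarrow> 0 \<le> g k" "\<And>k. k \<in> I \<Longrightarrow> g k \<le> h"
  shows "(\<Sum>k\<in>I. max 0 (2 * g k - sum g I)) \<le> h"
  \<comment> \<open>At most one term is positive: two of them would have overlaps adding up to more than the sum.\<close>
proof (cases "\<exists>k\<in>I. sum g I < 2 * g k")
  case True
  then obtain k where k: "k \<in> I" "sum g I < 2 * g k" by blast
  have others: "max 0 (2 * g i - sum g I) = 0" if "i \<in> I - {k}" for i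
  proof -
    have "sum g {i, k} \<le> sum g I"
      using that k g \<open>finite I\<close> by (intro sum_mono2) auto
    then show ?thesis using that k by auto
  qed
  have "g k \<le> sum g I"
    using k g \<open>finite I\<close> by (intro member_le_sum) auto
  then have "max 0 (2 * g k - sum g I) \<le> h"
    using g(2)[OF k(1)] \<open>0 \<le> h\<close> by linarith
  then show ?thesis
    using k \<open>finite I\<close> others by (simp add: sum.remove[of I k])
next
  case False
  then have "(\<Sum>k\<in>I. max 0 (2 * g k - sum g I)) = 0"
    by (intro sum.neutral) force
  then show ?thesis using \<open>0 \<le> h\<close> by simp
qed

text \<open>A pointwise comparison of indicators away from the null set where two of the
  \<open>P i\<close> meet. In reals it says that the loss at \<open>P j\<close> is at least its
  volume minus the excess of twice the overlap with \<open>P j\<close> over the total overlap; the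
  additive form avoids subtraction in \<open>ennreal\<close>.\<close>

lemma emeasure_overlaps_le:
  fixes A :: "'a::euclidean_space set" and P :: "'i \<Rightarrow> 'a set"
  assumes I: "finite I" "j \<in> I" and A [measurable]: "A \<in> sets borel"
    and P [measurable]: "\<And>k. k \<in> I \<Longrightarrow> P k \<in> sets borel"
    and disj: "\<And>i k. i \<in> I \<Longrightarrow> k \<in> I \<Longrightarrow> i \<noteq> k \<Longrightarrow> P i \<inter> P k \<in> null_sets lborel"
  shows "emeasure lborel (P j) + (\<Sum>i\<in>I. emeasure lborel (A \<inter> P i))
    \<le> emeasure lborel (sym_diff A (P j)) + 2 * emeasure lborel (A \<inter> P j)"
proof -
  have [measurable]: "P j \<in> sets borel" using I by simp
  have AE: "AE x in lborel. \<forall>i\<in>I. \<forall>k\<in>I. i \<noteq> k \<longrightarrow> x \<notin> P i \<inter> P k"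
  proof (intro AE_finite_allI I(1))
    fix i k assume "i \<in> I" "k \<in> I"
    then show "AE x in lborel. i \<noteq> k \<longrightarrow> x \<notin> P i \<inter> P k"
      using AE_not_in[OF disj[of i k]] by (cases "i = k") auto
  qed
  have "emeasure lborel (P j) + (\<Sum>i\<in>I. emeasure lborel (A \<inter> P i)) =
    (\<integral>\<^sup>+x. indicator (P j) x + (\<Sum>i\<in>I. indicator (A \<inter> P i) x) \<partial>lborel)"
    by (subst nn_integral_add) (auto simp: nn_integral_sum)
  also have "\<dots> \<le> (\<integral>\<^sup>+x. indicator (sym_diff A (P j)) x + 2 * indicator (A \<inter> P j) x \<partial>lborel)"
  proof (intro nn_integral_mono_AE, use AE in eventually_elim)
    case (elim x)
    show "indicator (P j) x + (\<Sum>i\<in>I. indicator (A \<inter> P i) x) \<le>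
      (indicator (sym_diff A (P j)) x + 2 * indicator (A \<inter> P j) x :: ennreal)"
    \<comment> \<open>On the union of the \<open>P k\<close> the two sides agree; off the union the
      left side is 0.\<close>
    proof (cases "\<exists>k\<in>I. x \<in> P k")
      case True
      then obtain k where k: "k \<in> I" "x \<in> P k" by blast
      then have "(\<Sum>i\<in>I - {k}. indicator (A \<inter> P i) x) = (0 :: ennreal)"
        using elim by (intro sum.neutral) (auto simp: indicator_def)
      then have "(\<Sum>i\<in>I. indicator (A \<inter> P i) x) = (indicator A x :: ennreal)"
        using sum.remove[OF I(1) k(1), of "\<lambda>i. indicator (A \<inter> P i) x :: ennreal"] k
        by (simp add: indicator_def del: sum_indicator_eq_card sum_of_bool_eq)
      moreover have "j = k" if "x \<in> P j" using that elim k I by blast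
      ultimately show ?thesis
        using k by (cases "x \<in> P j") (auto simp: indicator_def one_add_one)
    next
      case False
      then have "(\<Sum>i\<in>I. indicator (A \<inter> P i) x) = (0 :: ennreal)"
        by (intro sum.neutral) (auto simp: indicator_def)
      then show ?thesis using False I by (auto simp: indicator_def)
    qed
  qed
  also have "\<dots> = emeasure lborel (sym_diff A (P j)) + 2 * emeasure lborel (A \<inter> P j)"
    by (subst nn_integral_add) (auto simp: nn_integral_cmult)
  finally show ?thesis .
qed

text \<open>The overlap is the integral in \<open>x\<close> of the jointly measurable
  \<open>f\<close> over \<open>P\<close>, so Tonelli gives measurability in the sample.\<close>

lemma measurable_overlap:
  fixes Ghat :: "(nat \<Rightarrow> (real ^ 'd::finite) \<times> real) \<Rightarrow> (real ^ 'd) set"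
  assumes Ghat: "Ghat \<in> set_estimators n" and P [measurable]: "P \<in> sets borel"
  shows "(\<lambda>D. measure lborel (Ghat D \<inter> P)) \<in> borel_measurable (sample_space n)"
proof -
  obtain f where f [measurable]: "f \<in> borel_measurable (borel \<Otimes>\<^sub>M sample_space n)"
    and eq: "\<And>x D. D \<in> space (sample_space n) \<Longrightarrow> indicator (Ghat D) x = (f (x, D) :: real)"
    using Ghat unfolding set_estimators_def by blast
  have "measure lborel (Ghat D \<inter> P) = enn2real (\<integral>\<^sup>+x. ennreal (f (x, D)) * indicator P x \<partial>lborel)"
    if D: "D \<in> space (sample_space n)" for D
  proof -
    have "Ghat D \<in> sets borel" using Ghat D by (auto simp: set_estimators_def)
    then have "emeasure lborel (Ghat D \<inter> P) = (\<integral>\<^sup>+x. indicator (Ghat D \<inter> P) x \<partial>lborel)" by simp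
    also have "\<dots> = (\<integral>\<^sup>+x. ennreal (f (x, D)) * indicator P x \<partial>lborel)"
      by (intro nn_integral_cong) (auto simp: eq[OF D, symmetric] indicator_def)
    finally show ?thesis by (simp add: measure_def)
  qed
  moreover have "(\<lambda>D. enn2real (\<integral>\<^sup>+x. ennreal (f (x, D)) * indicator P x \<partial>lborel))
    \<in> borel_measurable (sample_space n)"
    by measurable
  ultimately show ?thesis
    by (simp cong: measurable_cong)
qed

text \<open>\<open>a k D\<close> is the excess of twice the overlap with \<open>P k\<close> over the
  total overlap, cut off at 0. The overlap inequality bounds the loss from below, and
  \<open>sum_excess_le\<close> caps the total excess for each sample: no estimate can favour many
  hypotheses at once.\<close>

lemma estimator_bonus:
  fixes Ghat :: "(nat \<Rightarrow> (real ^ 'd::finite) \<times> real) \<Rightarrow> (real ^ 'd) set" and P :: "'i \<Rightarrow> (real ^ 'd) set"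
  assumes Ghat: "Ghat \<in> set_estimators n" and I: "finite I" and h: "0 \<le> h"
    and P: "\<And>k. k \<in> I \<Longrightarrow> P k \<in> sets borel" "\<And>k. k \<in> I \<Longrightarrow> P k \<subseteq> cbox 0 1"
      "\<And>k. k \<in> I \<Longrightarrow> emeasure lborel (P k) = ennreal h"
    and disj: "\<And>i k. i \<in> I \<Longrightarrow> k \<in> I \<Longrightarrow> i \<noteq> k \<Longrightarrow> P i \<inter> P k \<in> null_sets lborel"
  shows "\<exists>a. (\<forall>k\<in>I. a k \<in> borel_measurable (sample_space n)) \<and> (\<forall>k D. 0 \<le> a k D) \<and>
    (\<forall>D\<in>space (sample_space n). (\<Sum>k\<in>I. a k D) \<le> h \<and>
      (\<forall>k\<in>I. ennreal (h - a k D) \<le> emeasure lborel (sym_diff (Ghat D) (P k))))"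
proof (intro exI conjI ballI allI)
  define g where "g k D = measure lborel (Ghat D \<inter> P k)" for k D
  define a where "a k D = max 0 (2 * g k D - (\<Sum>i\<in>I. g i D))" for k D
  have g_meas: "g k \<in> borel_measurable (sample_space n)" if "k \<in> I" for k
    unfolding g_def using Ghat P(1)[OF that] by (rule measurable_overlap)
  show "a k \<in> borel_measurable (sample_space n)" if "k \<in> I" for k
    unfolding a_def using that by (intro borel_measurable_max borel_measurable_diff
        borel_measurable_times borel_measurable_sum borel_measurable_const g_meas)
  show "0 \<le> a k D" for k D by (simp add: a_def)
  fix D :: "nat \<Rightarrow> (real ^ 'd) \<times> real" assume D: "D \<in> space (sample_space n)"
  have GD: "Ghat D \<in> sets borel" "Ghat D \<subseteq> cbox 0 1"
    using Ghat D by (auto simp: set_estimators_def)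
  have g: "emeasure lborel (Ghat D \<inter> P k) = ennreal (g k D)" "g k D \<le> h" if "k \<in> I" for k
  proof -
    have le: "emeasure lborel (Ghat D \<inter> P k) \<le> ennreal h"
      using P(1)[OF that] P(3)[OF that, symmetric] by (auto intro!: emeasure_mono)
    then show 1: "emeasure lborel (Ghat D \<inter> P k) = ennreal (g k D)"
      unfolding g_def by (intro emeasure_eq_ennreal_measure) (auto simp: top_unique)
    show "g k D \<le> h" using le h unfolding 1 by (simp add: g_def)
  qed
  have g0: "0 \<le> g k D" for k by (simp add: g_def)
  show "(\<Sum>k\<in>I. a k D) \<le> h"
    unfolding a_def using I h g g0 by (intro sum_excess_le) auto
  fix k assume k: "k \<in> I"
  \<comment> \<open>Both sets lie in the unit cube, so the loss is finite and the overlap inequality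
    can be moved to the reals.\<close>
  have "emeasure lborel (sym_diff (Ghat D) (P k)) \<le> emeasure lborel (cbox 0 1 :: (real ^ 'd) set)"
    using GD P(2)[OF k] by (intro emeasure_mono) auto
  then obtain e where e: "emeasure lborel (sym_diff (Ghat D) (P k)) = ennreal e" "0 \<le> e"
    by (cases "emeasure lborel (sym_diff (Ghat D) (P k))") (auto simp: emeasure_unit_cube top_unique)
  have "ennreal h + (\<Sum>i\<in>I. ennreal (g i D)) \<le> ennreal e + 2 * ennreal (g k D)"
    using emeasure_overlaps_le[where P=P, OF I k GD(1) P(1) disj] P(3)[OF k] g(1) k e by simp
  also have "ennreal h + (\<Sum>i\<in>I. ennreal (g i D)) = ennreal (h + (\<Sum>i\<in>I. g i D))"
    using h g0 by (simp add: sum_ennreal sum_nonneg)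
  also have "ennreal e + 2 * ennreal (g k D) = ennreal (e + 2 * g k D)"
    using e g0 by (simp add: ennreal_mult)
  finally have "h + (\<Sum>i\<in>I. g i D) \<le> e + 2 * g k D"
    using e g0[of k] by (subst (asm) ennreal_le_iff) auto
  then show "ennreal (h - a k D) \<le> emeasure lborel (sym_diff (Ghat D) (P k))"
    unfolding e a_def by (intro ennreal_leI) linarith
qed

section \<open>Change of measure and averaging over the hypotheses\<close>

lemma truncated_powr_bound:
  fixes L :: real
  assumes "0 < L" "0 < \<tau>" "0 \<le> s" "0 \<le> a" "a \<le> h"
  shows "L * a \<le> \<tau> * a + h * \<tau> powr - s * L powr (1 + s)"
proof (cases "L \<le> \<tau>")
  case True
  then have "L * a \<le> \<tau> * a" using assms by (intro mult_right_mono) auto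
  moreover have "0 \<le> h * \<tau> powr - s * L powr (1 + s)" using assms by simp
  ultimately show ?thesis by linarith
next
  \<comment> \<open>Above the threshold the factor \<open>(L / \<tau>) powr s\<close> is at least 1,
    so inserting it only enlarges \<open>L * h\<close>.\<close>
  case False
  have "1 \<le> (L / \<tau>) powr s" using False assms by (intro ge_one_powr_ge_zero) auto
  also have "\<dots> = L powr s * \<tau> powr - s"
    using assms by (simp add: powr_divide powr_minus_divide)
  finally have "L * h * 1 \<le> L * h * (L powr s * \<tau> powr - s)"
    using assms by (intro mult_left_mono) auto
  also have "\<dots> = h * \<tau> powr - s * L powr (1 + s)"
    using assms by (simp add: powr_add)
  finally have "L * h \<le> h * \<tau> powr - s * L powr (1 + s)" by simp
  moreover have "L * a \<le> L * h" using assms by (intro mult_left_mono) auto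
  moreover have "0 \<le> \<tau> * a" using assms by simp
  ultimately show ?thesis by linarith
qed

text \<open>All bonuses are compared under the one law for the empty set, where they sum to at most
  \<open>h\<close>; averaging over \<open>I\<close> therefore leaves only
  \<open>\<tau> / card I\<close>. The other term pays, through the moment of order
  \<open>1 + s\<close>, for samples whose likelihood ratio exceeds \<open>\<tau>\<close>.\<close>

lemma minimax_risk_lower_bound:
  fixes P :: "'i \<Rightarrow> (real ^ 'd::finite) set"
  assumes \<sigma>: "0 < \<sigma>" and I: "finite I" "I \<noteq> {}" and h: "0 \<le> h"
    and P: "\<And>k. k \<in> I \<Longrightarrow> P k \<in> sets borel" "\<And>k. k \<in> I \<Longrightarrow> P k \<subseteq> cbox 0 1"
      "\<And>k. k \<in> I \<Longrightarrow> emeasure lborel (P k) = ennreal h" "\<And>k. k \<in> I \<Longrightarrow> P k \<in> \<C>"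
    and disj: "\<And>i k. i \<in> I \<Longrightarrow> k \<in> I \<Longrightarrow> i \<noteq> k \<Longrightarrow> P i \<inter> P k \<in> null_sets lborel"
    and s: "0 \<le> s" and \<tau>: "0 < \<tau>"
  shows "ennreal (h * (1 - \<tau> / real (card I) -
      \<tau> powr - s * exp (real n * h * (exp ((1 + s) * s / (2 * \<sigma>\<^sup>2)) - 1))))
    \<le> minimax_risk (gaussian_noise \<sigma>) n \<C>"
  unfolding minimax_risk_def
proof (intro INF_greatest)
  fix Ghat :: "(nat \<Rightarrow> (real ^ 'd) \<times> real) \<Rightarrow> (real ^ 'd) set"
  assume Ghat: "Ghat \<in> set_estimators n"
  define E where "E = exp (real n * h * (exp ((1 + s) * s / (2 * \<sigma>\<^sup>2)) - 1))"
  define R where "R = (SUP G\<in>\<C>. risk (gaussian_noise \<sigma>) n Ghat G)"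
  obtain a where a [measurable]: "\<And>k. k \<in> I \<Longrightarrow> a k \<in> borel_measurable (sample_space n)"
    and a0: "\<And>k D. 0 \<le> a k D"
    and a_sum: "\<And>D. D \<in> space (sample_space n) \<Longrightarrow> (\<Sum>k\<in>I. a k D) \<le> h"
    and a_loss: "\<And>k D. k \<in> I \<Longrightarrow> D \<in> space (sample_space n) \<Longrightarrow>
      ennreal (h - a k D) \<le> emeasure lborel (sym_diff (Ghat D) (P k))"
    using estimator_bonus[where P=P, OF Ghat I(1) h P(1-3) disj] by blast
  have space: "space (sample_law (gaussian_noise \<sigma>) n G) = space (sample_space n)" for G :: "(real ^ 'd) set"
    by (rule sets_eq_imp_space_eq) simp
  have a_le: "a k D \<le> h" if "k \<in> I" "D \<in> space (sample_space n)" for k D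
    using a_sum[OF that(2)] member_le_sum[of k I "\<lambda>k. a k D"] a0 that I(1) by fastforce
  let ?P0 = "sample_law (gaussian_noise \<sigma>) n ({} :: (real ^ 'd) set)"
  \<comment> \<open>The constant \<open>h\<close> splits into \<open>h - a k D\<close>, whose mean
    under \<open>P k\<close> is at most \<open>R\<close>, and the bonus, which is moved to the
    reference law.\<close>
  have single: "ennreal h \<le> R + (ennreal \<tau> * (\<integral>\<^sup>+D. a k D \<partial>?P0) + ennreal (h * \<tau> powr - s * E))"
    if k: "k \<in> I" for k
  proof -
    let ?Pk = "sample_law (gaussian_noise \<sigma>) n (P k)"
    let ?L = "sample_ratio \<sigma> n (P k)"
    interpret Pk: prob_space ?Pk by (intro prob_space_sample_law \<sigma> P k)
    have [measurable]: "a k \<in> borel_measurable (sample_space n)" "P k \<in> sets borel"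
      using k P by auto
    have "(\<integral>\<^sup>+D. h - a k D \<partial>?Pk) \<le> risk (gaussian_noise \<sigma>) n Ghat (P k)"
      unfolding risk_def using k a_loss by (intro nn_integral_mono) (auto simp: space)
    also have "\<dots> \<le> R" unfolding R_def using P k by (intro SUP_upper) auto
    finally have R: "(\<integral>\<^sup>+D. h - a k D \<partial>?Pk) \<le> R" .
    have "(\<integral>\<^sup>+D. a k D \<partial>?Pk) = (\<integral>\<^sup>+D. ennreal (?L D) * ennreal (a k D) \<partial>?P0)"
      by (subst sample_law_eq_density[OF \<sigma>]) (auto simp: nn_integral_density)
    also have "\<dots> \<le> (\<integral>\<^sup>+D. ennreal \<tau> * ennreal (a k D) + ennreal (h * \<tau> powr - s) * ennreal (?L D powr (1 + s)) \<partial>?P0)"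
    proof (intro nn_integral_mono)
      fix D assume "D \<in> space ?P0"
      then have "?L D * a k D \<le> \<tau> * a k D + h * \<tau> powr - s * ?L D powr (1 + s)"
        using k s \<tau> a0 a_le by (intro truncated_powr_bound) (auto simp: space sample_ratio_pos)
      moreover have "0 \<le> \<tau> * a k D" "0 \<le> h * \<tau> powr - s" "0 \<le> a k D" "0 \<le> ?L D"
        using k h \<tau> a0 sample_ratio_pos[of \<sigma> n "P k" D] by auto
      ultimately show "ennreal (?L D) * ennreal (a k D) \<le>
        ennreal \<tau> * ennreal (a k D) + ennreal (h * \<tau> powr - s) * ennreal (?L D powr (1 + s))"
        using \<tau> by (simp add: ennreal_mult[symmetric] ennreal_plus[symmetric] del: ennreal_plus)
    qed
    also have "\<dots> = ennreal \<tau> * (\<integral>\<^sup>+D. a k D \<partial>?P0) +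
      ennreal (h * \<tau> powr - s) * (\<integral>\<^sup>+D. ?L D powr (1 + s) \<partial>?P0)"
      by (simp add: nn_integral_add nn_integral_cmult)
    also have "(\<integral>\<^sup>+D. ?L D powr (1 + s) \<partial>?P0) \<le> ennreal E"
      \<comment> \<open>The moment order is \<open>t = 1 + s\<close>, so \<open>t * (t - 1)\<close>
        becomes \<open>(1 + s) * s\<close>.\<close>
      unfolding E_def using \<sigma> P k h s by (intro nn_integral_sample_ratio_powr) auto
    finally have bonus: "(\<integral>\<^sup>+D. a k D \<partial>?Pk) \<le> ennreal \<tau> * (\<integral>\<^sup>+D. a k D \<partial>?P0) + ennreal (h * \<tau> powr - s * E)"
      using h by (simp add: ennreal_mult E_def add_left_mono mult_left_mono)
    have "ennreal h = (\<integral>\<^sup>+D. ennreal h \<partial>?Pk)" by (simp add: Pk.emeasure_space_1)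
    also have "\<dots> = (\<integral>\<^sup>+D. ennreal (h - a k D) + ennreal (a k D) \<partial>?Pk)"
      using k a0 a_le by (intro nn_integral_cong) (auto simp: space ennreal_plus[symmetric] simp del: ennreal_plus)
    also have "\<dots> = (\<integral>\<^sup>+D. h - a k D \<partial>?Pk) + (\<integral>\<^sup>+D. a k D \<partial>?Pk)"
      by (intro nn_integral_add) auto
    also have "\<dots> \<le> R + (ennreal \<tau> * (\<integral>\<^sup>+D. a k D \<partial>?P0) + ennreal (h * \<tau> powr - s * E))"
      using R bonus by (intro add_mono)
    finally show ?thesis .
  qed
  interpret P0: prob_space ?P0 by (intro prob_space_sample_law \<sigma>) auto
  \<comment> \<open>Since the reference law does not depend on \<open>k\<close>, the sum moves
    inside the integral and the pointwise cap applies.\<close>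
  have "(\<Sum>k\<in>I. \<integral>\<^sup>+D. a k D \<partial>?P0) = (\<integral>\<^sup>+D. (\<Sum>k\<in>I. ennreal (a k D)) \<partial>?P0)"
    by (subst nn_integral_sum) auto
  also have "\<dots> \<le> (\<integral>\<^sup>+D. ennreal h \<partial>?P0)"
    using a_sum a0 by (intro nn_integral_mono) (auto simp: space sum_ennreal intro!: ennreal_leI)
  also have "\<dots> = ennreal h" by (simp add: P0.emeasure_space_1)
  finally have total: "(\<Sum>k\<in>I. \<integral>\<^sup>+D. a k D \<partial>?P0) \<le> ennreal h" .
  have "of_nat (card I) * ennreal h = (\<Sum>k\<in>I. ennreal h)" by simp
  also have "\<dots> \<le> (\<Sum>k\<in>I. R + (ennreal \<tau> * (\<integral>\<^sup>+D. a k D \<partial>?P0) + ennreal (h * \<tau> powr - s * E)))"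
    by (intro sum_mono single) auto
  also have "\<dots> = of_nat (card I) * R + (ennreal \<tau> * (\<Sum>k\<in>I. \<integral>\<^sup>+D. a k D \<partial>?P0) + of_nat (card I) * ennreal (h * \<tau> powr - s * E))"
    by (simp add: sum.distrib sum_distrib_left)
  also have "\<dots> \<le> of_nat (card I) * R + (ennreal \<tau> * ennreal h + of_nat (card I) * ennreal (h * \<tau> powr - s * E))"
    using total by (intro add_mono mult_left_mono) auto
  finally have main: "of_nat (card I) * ennreal h \<le>
    of_nat (card I) * R + (ennreal \<tau> * ennreal h + of_nat (card I) * ennreal (h * \<tau> powr - s * E))" .
  have "ennreal (h * (1 - \<tau> / real (card I) - \<tau> powr - s * E)) \<le> R"
  \<comment> \<open>An infinite \<open>R\<close> is trivial; a finite one allows rearranging in the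
    reals and dividing by \<open>card I\<close>.\<close>
  proof (cases R)
    case (real r)
    have "0 \<le> h * \<tau> powr - s * E" using h by (simp add: E_def)
    then have "ennreal (real (card I) * h) \<le> ennreal (real (card I) * r + (\<tau> * h + real (card I) * (h * \<tau> powr - s * E)))"
      using main real h \<tau> by (simp add: ennreal_of_nat_eq_real_of_nat ennreal_mult)
    then have "real (card I) * h \<le> real (card I) * r + (\<tau> * h + real (card I) * (h * \<tau> powr - s * E))"
      using real h \<tau> \<open>0 \<le> h * \<tau> powr - s * E\<close> by (subst (asm) ennreal_le_iff) auto
    then have "h * (1 - \<tau> / real (card I) - \<tau> powr - s * E) \<le> r"
      using I by (simp add: field_simps card_gt_0_iff)
    then show ?thesis using real by (simp add: ennreal_leI)
  qed simp
  then show "ennreal (h * (1 - \<tau> / real (card I) -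
      \<tau> powr - s * exp (real n * h * (exp ((1 + s) * s / (2 * \<sigma>\<^sup>2)) - 1))))
    \<le> (SUP G\<in>\<C>. risk (gaussian_noise \<sigma>) n Ghat G)"
    by (simp add: E_def R_def)
qed

subsection \<open>Thin simplices\<close>

text \<open>Affine images of the standard simplex: the map sends hulls to hulls, so at most
  \<open>DIM('a) + 1\<close> vertices remain, and it multiplies the volume by \<open>1 / M\<close>.
  Different images lie in different slabs, which share at most a hyperplane.\<close>

lemma slab_simplices:
  fixes M :: nat
  assumes M: "0 < M"
  obtains P :: "nat \<Rightarrow> 'a::euclidean_space set"
  where "\<And>k. polytope (P k)"
    and "\<And>k. card {v. v extreme_point_of P k} \<le> DIM('a) + 1"
    and "\<And>k. k < M \<Longrightarrow> P k \<subseteq> cbox 0 One"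
    and "\<And>k. emeasure lborel (P k) = ennreal (1 / (fact DIM('a) * real M))"
    and "\<And>i k. i \<noteq> k \<Longrightarrow> P i \<inter> P k \<in> null_sets lborel"
proof -
  obtain e :: 'a where e: "e \<in> Basis" using nonempty_Basis by blast
  \<comment> \<open>\<open>g\<close> squeezes the direction \<open>e\<close> by
    \<open>1 / M\<close>, and \<open>t k\<close> moves the result to the slab where
    \<open>y \<bullet> e\<close> runs from \<open>k / M\<close> to
    \<open>(k + 1) / M\<close>.\<close>
  define c where "c j = (if j = e then 1 / real M else 1)" for j :: 'a
  define g where "g x = (\<Sum>j\<in>Basis. (c j * (x \<bullet> j)) *\<^sub>R j)" for x :: 'a
  define t where "t k = (real k / real M) *\<^sub>R e" for k
  define T where "T = (convex hull (insert 0 Basis) :: 'a set)"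
  define P where "P k = (\<lambda>x. t k + g x) ` T" for k
  have inner_g: "g x \<bullet> b = c b * (x \<bullet> b)" if "b \<in> Basis" for x b
    using that by (simp add: g_def inner_sum_left inner_Basis if_distrib sum.delta cong: if_cong)
  have c_pos: "0 < c j" for j using M by (simp add: c_def)
  have inner_t: "t k \<bullet> b = (if b = e then real k / real M else 0)" if "b \<in> Basis" for k b
    using that e by (simp add: t_def inner_Basis)
  have lin: "linear g"
    unfolding g_def by (intro linearI) (simp_all add: inner_add_left algebra_simps sum.distrib scaleR_sum_right)
  have inj: "inj (\<lambda>x. t k + g x)" for k
  proof (rule injI)
    fix x y assume "t k + g x = t k + g y"
    then have "g x = g y" by simp
    show "x = y"
    proof (rule euclidean_eqI)
      fix b :: 'a assume "b \<in> Basis"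
      then have "c b * (x \<bullet> b) = c b * (y \<bullet> b)"
        using inner_g \<open>g x = g y\<close> by metis
      then show "x \<bullet> b = y \<bullet> b" using c_pos[of b] by simp
    qed
  qed
  have T: "x \<in> T \<longleftrightarrow> (\<forall>b\<in>Basis. 0 \<le> x \<bullet> b) \<and> (\<Sum>b\<in>Basis. x \<bullet> b) \<le> 1" for x
    unfolding T_def std_simplex by simp
  have T_le: "x \<bullet> b \<le> 1" if "x \<in> T" "b \<in> Basis" for x b
    using that member_le_sum[of b Basis "\<lambda>b. x \<bullet> b"] by (auto simp: T)
  have hull: "P k = convex hull ((\<lambda>x. t k + g x) ` insert 0 Basis)" for k
    unfolding P_def T_def
    using convex_hull_translation[of "t k" "g ` insert 0 Basis"] convex_hull_linear_image[OF lin]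
    by (metis image_image)
  have fin: "finite ((\<lambda>x. t k + g x) ` insert 0 Basis)" for k by simp
  have poly: "polytope (P k)" for k
    unfolding hull polytope_def using fin by blast
  have card: "card {v. v extreme_point_of P k} \<le> DIM('a) + 1" for k
  proof -
    have "card {v. v extreme_point_of P k} \<le> card ((\<lambda>x. t k + g x) ` insert 0 Basis)"
      unfolding hull by (intro card_mono fin) (auto dest: extreme_point_of_convex_hull)
    also have "\<dots> \<le> card (insert 0 Basis :: 'a set)" by (intro card_image_le) simp
    also have "\<dots> \<le> DIM('a) + 1" by (simp add: card_insert_if)
    finally show ?thesis .
  qed
  have slab: "real k \<le> real M * (y \<bullet> e)" "real M * (y \<bullet> e) \<le> real k + 1" if y: "y \<in> P k" for k y
  proof -
    obtain x where x: "x \<in> T" "y = t k + g x" using y by (auto simp: P_def)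
    have "y \<bullet> e = (real k + x \<bullet> e) / real M"
      using e by (simp add: x inner_add_left inner_t inner_g c_def add_divide_distrib)
    then have "real M * (y \<bullet> e) = real k + x \<bullet> e" using M by simp
    moreover have "0 \<le> x \<bullet> e" "x \<bullet> e \<le> 1" using x e T T_le by auto
    ultimately show "real k \<le> real M * (y \<bullet> e)" "real M * (y \<bullet> e) \<le> real k + 1" by simp_all
  qed
  have sub: "P k \<subseteq> cbox 0 One" if k: "k < M" for k
  proof
    fix y assume y: "y \<in> P k"
    then obtain x where x: "x \<in> T" "y = t k + g x" by (auto simp: P_def)
    have "0 \<le> y \<bullet> b \<and> y \<bullet> b \<le> 1" if b: "b \<in> Basis" for b
    proof (cases "b = e")
      case True
      have "real k + 1 \<le> real M" using k by simp
      then have "0 \<le> real M * (y \<bullet> e)" "real M * (y \<bullet> e) \<le> real M * 1"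
        using slab[OF y] by linarith+
      then show ?thesis using True M by (simp add: zero_le_mult_iff)
    next
      case False
      then have "y \<bullet> b = x \<bullet> b" using x b by (simp add: inner_add_left inner_t inner_g c_def)
      then show ?thesis using x b T T_le by auto
    qed
    then show "y \<in> cbox 0 One" by (simp add: mem_box)
  qed
  have closed: "P k \<in> sets borel" for k
    using poly by (simp add: polytope_imp_closed borel_closed)
  have meas: "emeasure lborel (P k) = ennreal (1 / (fact DIM('a) * real M))" for k
  proof -
    have prod: "(\<Prod>j\<in>Basis. \<bar>c j\<bar>) = 1 / real M"
    proof -
      have "(\<Prod>j\<in>Basis - {e}. \<bar>c j\<bar>) = 1" by (intro prod.neutral) (simp add: c_def)
      then show ?thesis using e by (simp add: prod.remove[of Basis e] c_def)
    qed
    have [measurable]: "(\<lambda>x. t k + g x) \<in> borel_measurable borel"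
      unfolding g_def by (intro borel_measurable_continuous_onI continuous_intros)
    \<comment> \<open>Lebesgue measure is its image under the affine map times the Jacobian
      \<open>1 / M\<close>; at \<open>P k\<close> the image measure gives the volume of the preimage
      \<open>T\<close>.\<close>
    have "c j \<noteq> 0" for j using c_pos[of j] by simp
    then have eq: "lborel = density (distr lborel borel (\<lambda>x. t k + g x)) (\<lambda>_. \<Prod>j\<in>Basis. \<bar>c j\<bar>)"
      unfolding g_def by (rule lborel_affine_euclidean)
    have "emeasure lborel (P k) =
      emeasure (density (distr lborel borel (\<lambda>x. t k + g x)) (\<lambda>_. \<Prod>j\<in>Basis. \<bar>c j\<bar>)) (P k)"
      by (rule arg_cong[OF eq])
    also have "\<dots> = ennreal (1 / real M) * emeasure lborel ((\<lambda>x. t k + g x) -` P k)"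
      unfolding prod using closed by (simp add: emeasure_density_const emeasure_distr)
    also have "(\<lambda>x. t k + g x) -` P k = T"
      unfolding P_def using inj by (rule inj_vimage_image_eq)
    also have "ennreal (1 / real M) * emeasure lborel T = ennreal (1 / real M * (1 / fact DIM('a)))"
      unfolding T_def emeasure_std_simplex by (rule ennreal_mult[symmetric]) auto
    also have "1 / real M * (1 / fact DIM('a)) = 1 / (fact DIM('a) * real M)"
      by simp
    finally show ?thesis .
  qed
  have disj: "P i \<inter> P k \<in> null_sets lborel" if "i \<noteq> k" for i k
  proof -
    have less: "P i \<inter> P k \<in> null_sets lborel" if "i < k" for i k
    proof -
      \<comment> \<open>At a common point \<open>real M * (y \<bullet> e)\<close> is at most
        \<open>i + 1\<close> and at least \<open>k\<close>, hence equal to \<open>k\<close>.\<close>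
      have "real i + 1 \<le> real k" using that by simp
      then have "real M * (y \<bullet> e) = real k" if "y \<in> P i \<inter> P k" for y
        using slab[of y i] slab[of y k] that by auto
      then have "P i \<inter> P k \<subseteq> {y. e \<bullet> y = real k / real M}"
        using M by (auto simp: nonzero_eq_divide_eq inner_commute mult.commute)
      then have "negligible (P i \<inter> P k)"
        using e by (intro negligible_subset[OF negligible_hyperplane[of e]]) auto
      then show ?thesis
        using closed by (simp add: negligible_iff_null_sets null_sets_completion_iff)
    qed
    show ?thesis using less[of i k] less[of k i] that by (cases "i < k") (auto simp: Int_commute)
  qed
  show ?thesis by (rule that[OF poly card sub meas disj])
qed

text \<open>Nonempty interior follows from the volume: a convex set with empty interior is
  negligible, whereas these simplices have positive measure.\<close>

lemma polytope_class_simplices: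
  fixes M :: nat
  assumes M: "0 < M" and r: "CARD('d) + 1 \<le> r"
  obtains P :: "nat \<Rightarrow> (real ^ 'd::finite) set"
  where "\<And>k. k < M \<Longrightarrow> P k \<in> polytope_class r"
    and "\<And>k. k < M \<Longrightarrow> emeasure lborel (P k) = ennreal (1 / (fact CARD('d) * real M))"
    and "\<And>i k. i \<noteq> k \<Longrightarrow> P i \<inter> P k \<in> null_sets lborel"
proof (rule slab_simplices[OF M, where 'a = "real ^ 'd"])
  fix P :: "nat \<Rightarrow> (real ^ 'd) set"
  assume P: "\<And>k. polytope (P k)"
    "\<And>k. card {v. v extreme_point_of P k} \<le> DIM(real ^ 'd) + 1"
    "\<And>k. k < M \<Longrightarrow> P k \<subseteq> cbox 0 One"
    "\<And>k. emeasure lborel (P k) = ennreal (1 / (fact DIM(real ^ 'd) * real M))"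
    "\<And>i k. i \<noteq> k \<Longrightarrow> P i \<inter> P k \<in> null_sets lborel"
  have One: "One = (1 :: real ^ 'd)"
    by (rule euclidean_eqI) (simp add: inner_one_Basis)
  have "interior (P k) \<noteq> {}" for k
  proof
    assume "interior (P k) = {}"
    then have "negligible (P k)"
      using P(1) by (simp add: negligible_convex_interior polytope_imp_convex)
    then have "emeasure lborel (P k) = 0"
      using P(1) by (simp add: negligible_iff_null_sets null_sets_completion_iff polytope_imp_closed borel_closed null_setsD1)
    then show False using P(4)[of k] M by simp
  qed
  then have "P k \<in> polytope_class r" if "k < M" for k
    using P(1) P(2)[of k] P(3)[OF that] r unfolding polytope_class_def One by simp
  then show thesis using P(4,5) by (intro that) simp_all
qed

subsection \<open>Choice of parameters\<close>

lemma exp_minus_one_le: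
  fixes x :: real
  assumes "0 \<le> x" "x \<le> 1"
  shows "exp x - 1 \<le> 2 * x"
proof -
  have "x\<^sup>2 \<le> x" using assms by (simp add: power2_eq_square mult_left_le)
  then show ?thesis using exp_bound[of x] assms by linarith
qed

text \<open>From \<open>ln 2 \<le> ln 3 \<le> 2 * ln 2\<close> one gets
  \<open>0 \<le> \<alpha> \<le> 1 / 4\<close>.\<close>

lemma alpha_squared_le:
  fixes \<alpha> :: real
  assumes "\<alpha> = 1 / 2 - ln 2 / (2 * ln 3)"
  shows "\<alpha>\<^sup>2 \<le> 1 / 16"
proof -
  have ln3: "0 < ln (3 :: real)" by simp
  have "ln (3 :: real) \<le> ln (2 ^ 2)" by (subst ln_le_cancel_iff) auto
  then have "ln 3 \<le> 2 * ln (2 :: real)" by (simp only: ln_realpow of_nat_numeral)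
  moreover have "ln 2 \<le> ln (3 :: real)" by simp
  ultimately have "0 \<le> \<alpha>" "\<alpha> \<le> 1 / 4"
    using ln3 by (simp_all add: assms field_simps)
  then have "\<alpha>\<^sup>2 \<le> (1 / 4)\<^sup>2" by (intro power_mono)
  then show ?thesis by (simp add: power2_eq_square)
qed

text \<open>The conditions on \<open>n\<close> are kept explicit: \<open>big\<close> provides enough
  simplices for \<open>\<tau>\<close> to reach \<open>n powr (3/4)\<close>, and \<open>small\<close>
  makes the moment term at most \<open>1 / 4\<close>.\<close>

lemma minimax_risk_polytopes_ge:
  fixes \<sigma> :: real and n r :: nat
  defines "c \<equiv> \<sigma>\<^sup>2 * ln (real n) / real n" and "s \<equiv> min 1 (\<sigma>\<^sup>2)"
  assumes \<sigma>: "0 < \<sigma>" and n: "2 \<le> n" and r: "CARD('d::finite) + 1 \<le> r"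
    and big: "real n powr (3/4) \<le> 1 / (fact CARD('d) * c)" and small: "real n powr (- s / 4) \<le> 1 / 4"
  shows "ennreal (c / 16)
    \<le> minimax_risk (gaussian_noise \<sigma>) n (polytope_class r :: (real ^ 'd) set set)"
proof -
  define F where "F = (fact CARD('d) :: real)"
  have F: "0 < F" by (simp add: F_def)
  have c: "0 < c" using \<sigma> n by (simp add: c_def)
  \<comment> \<open>\<open>s \<le> 1\<close> bounds \<open>1 + s\<close> by 2, and
    \<open>s \<le> \<sigma>\<^sup>2\<close> then keeps \<open>\<kappa>\<close> at most 1, the range
    in which \<open>exp \<kappa> - 1 \<le> 2 * \<kappa>\<close>.\<close>
  have s: "0 < s" "s \<le> 1" "s \<le> \<sigma>\<^sup>2" using \<sigma> by (auto simp: s_def)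
  \<comment> \<open>Without rounding, \<open>h\<close> would be \<open>c / 8\<close>. Since
    \<open>8 / (F * c)\<close> turns out to be at least 8, the floor loses less than half, and
    \<open>h\<close> stays below \<open>c / 4\<close>.\<close>
  define M where "M = nat \<lfloor>8 / (F * c)\<rfloor>"
  have "1 \<le> real n powr (3/4)" using n by (intro ge_one_powr_ge_zero) auto
  then have "1 \<le> 1 / (F * c)" using big by (simp add: F_def)
  moreover have "8 / (F * c) = 8 * (1 / (F * c))" by simp
  ultimately have M: "4 / (F * c) \<le> real M" "real M \<le> 8 / (F * c)" "0 < M"
    unfolding M_def by linarith+
  define h where "h = 1 / (F * real M)"
  have h: "c / 8 \<le> h" "h \<le> c / 4" "0 \<le> h"
    using M F c by (simp_all add: h_def field_simps)
  define \<kappa> where "\<kappa> = (1 + s) * s / (2 * \<sigma>\<^sup>2)"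
  have \<kappa>0: "0 \<le> \<kappa>" using s by (simp add: \<kappa>_def)
  have "\<kappa> \<le> 2 * s / (2 * \<sigma>\<^sup>2)"
    unfolding \<kappa>_def using s by (intro divide_right_mono mult_right_mono) auto
  also have "\<dots> = s / \<sigma>\<^sup>2" by simp
  finally have \<kappa>: "\<kappa> \<le> s / \<sigma>\<^sup>2" .
  also have "s / \<sigma>\<^sup>2 \<le> 1" using s \<sigma> by simp
  finally have \<kappa>1: "\<kappa> \<le> 1" .
  define E where "E = exp (real n * h * (exp \<kappa> - 1))"
  \<comment> \<open>Here \<open>n * c = \<sigma>\<^sup>2 * ln n\<close> cancels the noise level, so
    \<open>E\<close> is at most a power of \<open>n\<close> with exponent
    \<open>s / 2\<close>.\<close>
  have "real n * h * (exp \<kappa> - 1) \<le> real n * (c / 4) * (2 * (s / \<sigma>\<^sup>2))"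
    using exp_minus_one_le[OF \<kappa>0 \<kappa>1] \<kappa> \<kappa>0 h s c by (intro mult_mono mult_left_mono) auto
  also have "\<dots> = s / 2 * ln (real n)"
    using \<sigma> n by (simp add: c_def field_simps)
  finally have E: "E \<le> real n powr (s / 2)"
    using n by (simp add: E_def powr_def)
  \<comment> \<open>This makes \<open>\<tau> / M\<close> a quarter, while
    \<open>\<tau> powr - s\<close> still decays like \<open>n powr (- 3 * s / 4)\<close> or faster,
    which outweighs \<open>E\<close>.\<close>
  define \<tau> where "\<tau> = real M / 4"
  have \<tau>: "0 < \<tau>" "real n powr (3/4) \<le> \<tau>"
    using M big by (simp_all add: \<tau>_def F_def)
  have "\<tau> powr - s \<le> (real n powr (3/4)) powr - s"
    using \<tau> n s by (intro powr_mono2') auto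
  then have "\<tau> powr - s * E \<le> (real n powr (3/4)) powr - s * real n powr (s / 2)"
    using E by (intro mult_mono) (auto simp: E_def)
  also have "\<dots> = real n powr (- s / 4)"
    by (simp add: powr_powr powr_add[symmetric])
  finally have \<delta>: "\<tau> powr - s * E \<le> 1 / 4" using small by linarith
  show ?thesis
  proof (rule polytope_class_simplices[OF \<open>0 < M\<close> r])
    fix P :: "nat \<Rightarrow> (real ^ 'd) set"
    assume P: "\<And>k. k < M \<Longrightarrow> P k \<in> polytope_class r"
      "\<And>k. k < M \<Longrightarrow> emeasure lborel (P k) = ennreal (1 / (fact CARD('d) * real M))"
      "\<And>i k. i \<noteq> k \<Longrightarrow> P i \<inter> P k \<in> null_sets lborel"
    \<comment> \<open>Two losses of at most a quarter leave half of \<open>h\<close>, and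
      \<open>h\<close> is at least \<open>c / 8\<close>.\<close>
    have "c / 16 \<le> h * (1 / 2)" using h by simp
    also have "\<dots> \<le> h * (1 - \<tau> / real M - \<tau> powr - s * E)"
      using \<delta> h M by (intro mult_left_mono) (auto simp: \<tau>_def)
    finally have "ennreal (c / 16) \<le> ennreal (h * (1 - \<tau> / real (card {..<M}) - \<tau> powr - s * E))"
      by (intro ennreal_leI) simp
    also have "\<dots> \<le> minimax_risk (gaussian_noise \<sigma>) n (polytope_class r :: (real ^ 'd) set set)"
      unfolding E_def \<kappa>_def
    proof (rule minimax_risk_lower_bound[where P = P])
      fix k assume "k \<in> {..<M}"
      then have k: "k < M" by simp
      show "P k \<in> polytope_class r" using P(1) k .
      then show "P k \<in> sets borel" "P k \<subseteq> cbox 0 1"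
        by (auto simp: polytope_class_def polytope_imp_closed borel_closed)
      show "emeasure lborel (P k) = ennreal h" using P(2)[OF k] by (simp add: h_def F_def)
    qed (use \<sigma> M h P(3) s \<tau> in auto)
    finally show ?thesis .
  qed
qed

text \<open>One threshold \<open>N\<close> serves every \<open>r\<close>: the simplices have at most
  \<open>CARD('d) + 1\<close> vertices, so the same family lies in each class.\<close>

theorem theorem2:
  fixes \<sigma> \<alpha> :: real
  assumes dim: "2 \<le> CARD('d::finite)"
    and sigma: "0 < \<sigma>"
    and alpha: "\<alpha> = 1 / 2 - ln 2 / (2 * ln 3)"
  shows "\<exists>N::nat. \<forall>n\<ge>N. \<forall>r\<ge>CARD('d) + 1.
           ennreal (\<alpha>\<^sup>2 * \<sigma>\<^sup>2 * ln (real n) / real n)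
             \<le> minimax_risk (gaussian_noise \<sigma>) n (polytope_class r :: (real ^ 'd) set set)"
proof -
  define K s where "K = fact CARD('d) * \<sigma>\<^sup>2" and "s = min 1 (\<sigma>\<^sup>2)"
  have pos: "0 < K" "0 < s" using sigma by (auto simp: K_def s_def)
  \<comment> \<open>The right side is \<open>1 / (fact CARD('d) * c)\<close> for
    \<open>c = \<sigma>\<^sup>2 * ln n / n\<close>; it exceeds \<open>n powr (3/4)\<close> because a
    power of \<open>n\<close> outgrows the logarithm.\<close>
  have "eventually (\<lambda>n. real n powr (3/4) \<le> real n / (K * ln (real n))) sequentially"
    using pos by real_asymp
  moreover have "eventually (\<lambda>n. real n powr (- s / 4) \<le> 1 / 4) sequentially"
    using pos by real_asymp
  ultimately have "eventually (\<lambda>n. \<forall>r\<ge>CARD('d) + 1.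
           ennreal (\<alpha>\<^sup>2 * \<sigma>\<^sup>2 * ln (real n) / real n)
             \<le> minimax_risk (gaussian_noise \<sigma>) n (polytope_class r :: (real ^ 'd) set set)) sequentially"
    using eventually_ge_at_top[of 2]
  proof eventually_elim
    case (elim n)
    show ?case
    proof (intro allI impI)
      fix r assume r: "CARD('d) + 1 \<le> r"
      have "\<alpha>\<^sup>2 * (\<sigma>\<^sup>2 * ln (real n) / real n) \<le> 1 / 16 * (\<sigma>\<^sup>2 * ln (real n) / real n)"
        using elim by (intro mult_right_mono alpha_squared_le alpha) auto
      then have "ennreal (\<alpha>\<^sup>2 * \<sigma>\<^sup>2 * ln (real n) / real n) \<le> ennreal (\<sigma>\<^sup>2 * ln (real n) / real n / 16)"
        by (intro ennreal_leI) (simp add: mult.assoc)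
      also have "\<dots> \<le> minimax_risk (gaussian_noise \<sigma>) n (polytope_class r :: (real ^ 'd) set set)"
        using elim r sigma by (intro minimax_risk_polytopes_ge) (auto simp: K_def s_def mult.assoc)
      finally show "ennreal (\<alpha>\<^sup>2 * \<sigma>\<^sup>2 * ln (real n) / real n)
        \<le> minimax_risk (gaussian_noise \<sigma>) n (polytope_class r :: (real ^ 'd) set set)" .
    qed
  qed
  then show ?thesis by (simp add: eventually_sequentially)
qed

end
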